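(* Let $D$ be a tournament. Then \[\#\{\text{hamps of }D\}\equiv 1+2\cdot\#\{\text{nontrivial odd }D\text{-cycles}\}\pmod 4.\]
   Context: A tournament is a digraph $D=(V,A)$ ($V$ finite, $A\subseteq V\times V$) with no loops $(u,u)\in A$ and such that for any two distinct $u,v\in V$ exactly one of $(u,v),(v,u)$ lies in $A$. A $D$-path is a nonempty tuple $v=(v_1,\dots,v_k)$ of distinct vertices with $(v_i,v_{i+1})\in A$ for all $i\in[k-1]$; a hamp of $D$ is a $D$-path containing every vertex; the empty list counts as a hamp of the empty tournament. Two nonempty tuples are rotation-equivalent if one is a cyclic rotation of the other. A $D$-cycle is a rotation-equivalence class $\gamma$ of nonempty tuples $(v_1,\dots,v_k)$ of distinct vertices with $(v_1,v_2),\dots,(v_{k-1},v_k),(v_k,v_1)$ all in $A$; its length is $k$; it is odd if $k$ is odd and nontrivial if $k>1$. *)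

theory Defs
  imports "HOL-Number_Theory.Cong"
begin

definition digraph :: "'a set \<Rightarrow> ('a \<times> 'a) set \<Rightarrow> bool" where
  "digraph V A \<longleftrightarrow> finite V \<and> A \<subseteq> V \<times> V"

definition tournament :: "'a set \<Rightarrow> ('a \<times> 'a) set \<Rightarrow> bool" where
  "tournament V A \<longleftrightarrow> digraph V A \<and>
     (\<forall>u\<in>V. (u, u) \<notin> A) \<and>
     (\<forall>u\<in>V. \<forall>v\<in>V. u \<noteq> v \<longrightarrow> ((u, v) \<in> A \<longleftrightarrow> (v, u) \<notin> A))"

definition dpath :: "'a set \<Rightarrow> ('a \<times> 'a) set \<Rightarrow> 'a list \<Rightarrow> bool" where
  "dpath V A xs \<longleftrightarrow> xs \<noteq> [] \<and> distinct xs \<and> set xs \<subseteq> V \<and>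
     (\<forall>i. Suc i < length xs \<longrightarrow> (xs ! i, xs ! Suc i) \<in> A)"

text \<open>The first disjunct is the convention that the empty list is a hamp (Hamiltonian path) of the
  empty digraph, although it is not a path.\<close>

definition hamp :: "'a set \<Rightarrow> ('a \<times> 'a) set \<Rightarrow> 'a list \<Rightarrow> bool" where
  "hamp V A xs \<longleftrightarrow> (V = {} \<and> xs = []) \<or> (dpath V A xs \<and> V \<subseteq> set xs)"

definition rot_equiv :: "('a list \<times> 'a list) set" where
  "rot_equiv = {(xs, ys). xs \<noteq> [] \<and> ys \<noteq> [] \<and> (\<exists>n. ys = rotate n xs)}"

definition cyclic_tuple :: "'a set \<Rightarrow> ('a \<times> 'a) set \<Rightarrow> 'a list \<Rightarrow> bool" where
  "cyclic_tuple V A xs \<longleftrightarrow> xs \<noteq> [] \<and> distinct xs \<and> set xs \<subseteq> V \<and>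
     (\<forall>i. Suc i < length xs \<longrightarrow> (xs ! i, xs ! Suc i) \<in> A) \<and> (last xs, hd xs) \<in> A"

definition dcycles :: "'a set \<Rightarrow> ('a \<times> 'a) set \<Rightarrow> 'a list set set" where
  "dcycles V A = {xs. cyclic_tuple V A xs} // rot_equiv"

text \<open>All tuples in a rotation class have the same length.\<close>

definition cycle_length :: "'a list set \<Rightarrow> nat" where
  "cycle_length \<gamma> = (THE k. \<forall>xs\<in>\<gamma>. length xs = k)"

definition nontrivial_odd_dcycles :: "'a set \<Rightarrow> ('a \<times> 'a) set \<Rightarrow> 'a list set set" where
  "nontrivial_odd_dcycles V A = {\<gamma> \<in> dcycles V A. odd (cycle_length \<gamma>) \<and> cycle_length \<gamma> > 1}"

lemma equiv_rot_equiv: "equiv {xs :: 'a list. xs \<noteq> []} rot_equiv"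
proof (rule equivI)
  show "rot_equiv \<subseteq> {xs :: 'a list. xs \<noteq> []} \<times> {xs. xs \<noteq> []}"
    by (auto simp: rot_equiv_def)
  show "refl_on {xs :: 'a list. xs \<noteq> []} rot_equiv"
    by (auto simp: refl_on_def rot_equiv_def intro: exI[of _ 0])
  show "sym (rot_equiv :: ('a list \<times> 'a list) set)"
  proof (rule symI)
    fix xs ys :: "'a list"
    assume "(xs, ys) \<in> rot_equiv"
    then obtain n where n: "xs \<noteq> []" "ys \<noteq> []" "ys = rotate n xs"
      by (auto simp: rot_equiv_def)
    have "rotate (length xs - n mod length xs) ys
        = rotate (length xs - n mod length xs + n mod length xs) xs"
      using n by (metis rotate_conv_mod rotate_rotate)
    also have "\<dots> = xs"
      using n by simp
    finally show "(ys, xs) \<in> rot_equiv"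
      using n by (auto simp: rot_equiv_def intro: sym)
  qed
  show "trans (rot_equiv :: ('a list \<times> 'a list) set)"
    by (auto simp: trans_def rot_equiv_def rotate_rotate)
qed

lemma cycle_length_class:
  assumes "xs \<noteq> []"
  shows "cycle_length (rot_equiv `` {xs}) = length xs"
  unfolding cycle_length_def
proof (rule the_equality)
  show "\<forall>ys\<in>rot_equiv `` {xs}. length ys = length xs"
    by (auto simp: rot_equiv_def)
  have "xs \<in> rot_equiv `` {xs}"
    using assms by (auto simp: rot_equiv_def intro: exI[of _ 0])
  then show "k = length xs" if "\<forall>ys\<in>rot_equiv `` {xs}. length ys = k" for k
    using that by auto
qed

end

theory Submission imports Defs begin

text \<open>
  Let \<open>h S\<close> count the arrangements of \<open>S\<close> in which no arc joins consecutive entries; in a tournament,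
  reversal turns these into the hamps of \<open>S\<close>. Fix \<open>v \<in> S\<close>. Write such an arrangement as \<open>p v q\<close>, expand
  the condition on \<open>v q\<close> by inclusion-exclusion over the prefixes \<open>q1\<close> of \<open>q = q1 q2\<close> such that \<open>v q1\<close>
  follows arcs, and collect the terms by the cyclic word \<open>v c\<close> with \<open>c = q1 p\<close>. For fixed \<open>c\<close> the sum
  telescopes, and \<open>h S\<close> becomes the sum of \<open>w c * h (S - {v} - c)\<close> over all words \<open>c\<close> in \<open>S - {v}\<close>,
  where \<open>w c\<close> is \<open>1\<close> if the closed word \<open>v c v\<close> uses no arc, \<open>(-1)^|c|\<close> if it uses only arcs, and \<open>0\<close>
  otherwise. In a tournament, pairing \<open>c\<close> with its reversal cancels the even cycles and doubles the odd
  ones, so \<open>h S = h (S - {v}) + 2 * (\<Sum>c. h (S - {v} - c))\<close>, summed over the nontrivial odd cycles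
  through \<open>v\<close>. Hence every \<open>h S\<close> is odd, and modulo 4 removing \<open>v\<close> changes \<open>h S\<close> by twice the number
  of these cycles.
\<close>

section \<open>Arrangements and their arc-free counts\<close>

definition arrangements :: "'a set \<Rightarrow> 'a list set" where
  "arrangements S = {xs. distinct xs \<and> set xs = S}"

definition partial_arrangements :: "'a set \<Rightarrow> 'a list set" where
  "partial_arrangements S = {xs. distinct xs \<and> set xs \<subseteq> S}"

abbreviation arc_walk :: "('a \<times> 'a) set \<Rightarrow> 'a list \<Rightarrow> bool" where
  "arc_walk A \<equiv> successively (\<lambda>x y. (x, y) \<in> A)"

abbreviation arc_free :: "('a \<times> 'a) set \<Rightarrow> 'a list \<Rightarrow> bool" where
  "arc_free A \<equiv> successively (\<lambda>x y. (x, y) \<notin> A)"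

definition arc_free_count :: "('a \<times> 'a) set \<Rightarrow> 'a set \<Rightarrow> int" where
  "arc_free_count A S = (\<Sum>w\<in>arrangements S. of_bool (arc_free A w))"

lemma finite_partial_arrangements: "finite S \<Longrightarrow> finite (partial_arrangements S)"
  unfolding partial_arrangements_def
  by (rule finite_subset[OF _ finite_subset_distinct[of S]]) auto

lemma finite_arrangements: "finite S \<Longrightarrow> finite (arrangements S)"
  by (rule finite_subset[OF _ finite_partial_arrangements[of S]])
    (auto simp: arrangements_def partial_arrangements_def)

lemma arc_free_count_empty [simp]: "arc_free_count A {} = 1"
proof -
  have "arrangements {} = {[] :: 'a list}"
    by (auto simp: arrangements_def)
  then show ?thesis
    by (simp add: arc_free_count_def)
qed

section \<open>Inclusion-exclusion and the sum over cyclic words\<close>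

text \<open>For a tail \<open>y # q\<close>, the term \<open>j = 0\<close> is the indicator that
  \<open>y # q\<close> is arc-free. Every later term contains the arc \<open>(x, y)\<close>, and
  together they are minus the expansion for \<open>y # q\<close>. So that indicator gets the factor
  1 minus [\<open>(x, y)\<close> is an arc].\<close>

lemma arc_free_Cons_expansion:
  "(of_bool (arc_free A (x # q)) :: int) =
     (\<Sum>j\<le>length q. (-1) ^ j * of_bool (arc_walk A (x # take j q)) * of_bool (arc_free A (drop j q)))"
proof (induction q arbitrary: x)
  case Nil
  show ?case by simp
next
  case (Cons y q)
  have "(\<Sum>j\<le>length (y # q). (-1) ^ j * of_bool (arc_walk A (x # take j (y # q)))
            * of_bool (arc_free A (drop j (y # q)))) =
        (of_bool (arc_free A (y # q)) :: int) -
        of_bool ((x, y) \<in> A) * (\<Sum>j\<le>length q. (-1) ^ j * of_bool (arc_walk A (y # take j q))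
            * of_bool (arc_free A (drop j q)))"
    by (simp add: sum.atMost_Suc_shift sum_distrib_left sum_negf of_bool_conj algebra_simps
        del: sum.atMost_Suc)
  also have "\<dots> = of_bool (arc_free A (x # y # q))"
    unfolding Cons.IH[symmetric] by simp
  finally show ?case by simp
qed

text \<open>This is the previous expansion for the tail \<open>c @ [v]\<close>, whose index runs up
  to \<open>length c + 1\<close>. The last term, of sign opposite to \<open>(-1) ^ length c\<close>,
  has been moved to the other side.\<close>

lemma arc_free_cyclic_expansion:
  "(\<Sum>j\<le>length c. (-1) ^ j * of_bool (arc_walk A (v # take j c)) * of_bool (arc_free A (drop j c @ [v])) :: int) =
     of_bool (arc_free A (v # c @ [v])) + (-1) ^ length c * of_bool (arc_walk A (v # c @ [v]))"
  using arc_free_Cons_expansion[of A v "c @ [v]"] by simp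

lemma arc_free_count_expansion:
  assumes S: "finite S" and v: "v \<in> S"
  shows "arc_free_count A S =
    (\<Sum>c\<in>partial_arrangements (S - {v}).
       (of_bool (arc_free A (v # c @ [v])) + (-1) ^ length c * of_bool (arc_walk A (v # c @ [v])))
       * arc_free_count A (S - {v} - set c))"
proof -
  define T where "T = {(p, q). p @ v # q \<in> arrangements S}"
  define U where "U = Sigma (partial_arrangements (S - {v})) (\<lambda>c. arrangements (S - {v} - set c))"
  have finU: "finite U"
    unfolding U_def using S by (intro finite_SigmaI finite_partial_arrangements finite_arrangements) auto
  have inj: "inj_on (\<lambda>(p, q). p @ v # q) T"
    by (auto simp: inj_on_def T_def arrangements_def append_Cons_eq_iff)
  have arr: "arrangements S = (\<lambda>(p, q). p @ v # q) ` T"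
  proof
    show "arrangements S \<subseteq> (\<lambda>(p, q). p @ v # q) ` T"
    proof
      fix w assume w: "w \<in> arrangements S"
      then obtain p q where "w = p @ v # q"
        using v by (metis (mono_tags, lifting) arrangements_def mem_Collect_eq split_list)
      with w show "w \<in> (\<lambda>(p, q). p @ v # q) ` T"
        by (force simp: T_def)
    qed
  qed (auto simp: T_def)
  have finT: "finite T"
    using finite_arrangements[OF S] inj unfolding arr by (rule finite_imageD)
  \<comment> \<open>With \<open>p = drop j c\<close> and \<open>q1 = take j c\<close>, the two
    cyclic factors test \<open>v q1\<close> for arcs and \<open>p v\<close> for their absence;
    \<open>u\<close> is the rest \<open>q2\<close> of \<open>q\<close>.\<close>
  define f :: "'a list \<Rightarrow> 'a list \<Rightarrow> nat \<Rightarrow> int" where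
    "f = (\<lambda>c u j. (-1) ^ j * of_bool (arc_walk A (v # take j c))
       * of_bool (arc_free A (drop j c @ [v])) * of_bool (arc_free A u))"
  have "arc_free_count A S = (\<Sum>(p, q)\<in>T. of_bool (arc_free A (p @ v # q)))"
    unfolding arc_free_count_def arr by (subst sum.reindex[OF inj]) (simp add: case_prod_unfold)
  also have "\<dots> = (\<Sum>(p, q)\<in>T. \<Sum>j\<le>length q. f (take j q @ p) (drop j q) j)"
  proof (rule sum.cong[OF refl], clarify)
    fix p q
    have "(of_bool (arc_free A (p @ v # q)) :: int) = of_bool (arc_free A (p @ [v])) * of_bool (arc_free A (v # q))"
      by (auto simp: successively_append_iff of_bool_def)
    also have "\<dots> = (\<Sum>j\<le>length q. f (take j q @ p) (drop j q) j)"
      unfolding arc_free_Cons_expansion[of A v q] sum_distrib_left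
      by (intro sum.cong refl) (simp add: f_def)
    finally show "of_bool (arc_free A (p @ v # q)) = (\<Sum>j\<le>length q. f (take j q @ p) (drop j q) j)" .
  qed
  also have "\<dots> = (\<Sum>((p, q), j)\<in>Sigma T (\<lambda>(p, q). {..length q}). f (take j q @ p) (drop j q) j)"
    using finT by (subst sum.Sigma[symmetric]) (auto simp: case_prod_unfold)
  \<comment> \<open>The index \<open>j\<close> records where \<open>c\<close> was glued together, so
    cutting \<open>c\<close> there recovers \<open>p\<close> and \<open>q\<close>. The bounds
    correspond: every \<open>j\<close> up to \<open>length c\<close> is a possible length of
    \<open>q1\<close>.\<close>
  also have "\<dots> = (\<Sum>((c, u), j)\<in>Sigma U (\<lambda>(c, u). {..length c}). f c u j)"
  proof (rule sum.reindex_bij_witness[where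
        i = "\<lambda>((c, u), j). ((drop j c, take j c @ u), j)" and
        j = "\<lambda>((p, q), j). ((take j q @ p, drop j q), j)"], goal_cases)
    case (2 a)
    then obtain p q j where a: "a = ((p, q), j)" "distinct (p @ v # q)" "set (p @ v # q) = S" "j \<le> length q"
      by (auto simp: T_def arrangements_def)
    have "set (take j q) \<inter> set (drop j q) = {}" "set (take j q) \<union> set (drop j q) = set q"
      using a by (simp add: set_take_disj_set_drop_if_distinct, metis append_take_drop_id set_append)
    with a show ?case
      by (auto simp: U_def arrangements_def partial_arrangements_def dest: in_set_takeD in_set_dropD)
  next
    case (4 b)
    then obtain c u j where b: "b = ((c, u), j)" "distinct c" "set c \<subseteq> S - {v}" "distinct u"
        "set u = S - {v} - set c" "j \<le> length c"
      by (auto simp: U_def arrangements_def partial_arrangements_def)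
    have "set (take j c) \<inter> set (drop j c) = {}" "set (take j c) \<union> set (drop j c) = set c"
      using b by (simp add: set_take_disj_set_drop_if_distinct, metis append_take_drop_id set_append)
    with b v show ?case
      by (auto simp: T_def arrangements_def dest: in_set_takeD in_set_dropD)
  qed (auto simp: f_def)
  also have "\<dots> = (\<Sum>(c, u)\<in>U. \<Sum>j\<le>length c. f c u j)"
    using finU by (simp add: case_prod_unfold sum.Sigma)
  also have "\<dots> = (\<Sum>(c, u)\<in>U. (of_bool (arc_free A (v # c @ [v])) +
      (-1) ^ length c * of_bool (arc_walk A (v # c @ [v]))) * of_bool (arc_free A u))"
    unfolding arc_free_cyclic_expansion[symmetric] f_def sum_distrib_right ..
  also have "\<dots> = (\<Sum>c\<in>partial_arrangements (S - {v}). \<Sum>u\<in>arrangements (S - {v} - set c).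
      (of_bool (arc_free A (v # c @ [v])) +
      (-1) ^ length c * of_bool (arc_walk A (v # c @ [v]))) * of_bool (arc_free A u))"
    unfolding U_def using S
    by (subst sum.Sigma) (auto intro: finite_partial_arrangements finite_arrangements)
  finally show ?thesis
    unfolding arc_free_count_def sum_distrib_left .
qed

section \<open>Reversal in tournaments and the recursion on a vertex\<close>

lemma tournament_not_arc_iff:
  assumes "tournament V A" "u \<in> V" "v \<in> V" "u \<noteq> v"
  shows "(u, v) \<notin> A \<longleftrightarrow> (v, u) \<in> A"
  using assms unfolding tournament_def by metis

lemma distinct_adj_if_distinct: "distinct xs \<Longrightarrow> distinct_adj xs"
  by (simp add: distinct_adj_conv_nth nth_eq_iff_index_eq)

text \<open>Between distinct neighbours a missing arc is a reversed arc. Only neighbours have to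
  differ, so that closed words \<open>v c v\<close> are covered.\<close>

lemma arc_free_iff_arc_walk_rev:
  assumes "tournament V A" "set xs \<subseteq> V" "distinct_adj xs"
  shows "arc_free A xs \<longleftrightarrow> arc_walk A (rev xs)"
  using assms(2,3)
proof (induction xs rule: induct_list012)
  case (3 x y zs)
  then show ?case
    using tournament_not_arc_iff[OF assms(1), of x y] by (auto simp: successively_append_iff)
qed auto

lemma tournament_arc_free_count:
  assumes T: "tournament V A" and "S \<subseteq> V"
  shows "arc_free_count A S = int (card {xs. hamp S A xs})"
proof -
  have fin: "finite S"
    using assms finite_subset by (auto simp: tournament_def digraph_def)
  have "arc_free_count A S = (\<Sum>w\<in>arrangements S. of_bool (arc_walk A (rev w)))"
    unfolding arc_free_count_def using assms
    by (intro sum.cong refl) (auto simp: arrangements_def arc_free_iff_arc_walk_rev distinct_adj_if_distinct)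
  also have "\<dots> = (\<Sum>w\<in>arrangements S. of_bool (arc_walk A w))"
    by (rule sum.reindex_bij_witness[of _ rev rev]) (auto simp: arrangements_def)
  also have "\<dots> = int (card {w \<in> arrangements S. arc_walk A w})"
    using finite_arrangements[OF fin] by (simp add: sum_of_bool_eq Int_def)
  \<comment> \<open>For empty \<open>S\<close> both sides are \<open>{[]}\<close>, by the convention
    in \<open>hamp\<close>.\<close>
  also have "{w \<in> arrangements S. arc_walk A w} = {xs. hamp S A xs}"
    by (auto simp: hamp_def dpath_def arrangements_def successively_conv_nth)
  finally show ?thesis .
qed

lemma tournament_arc_free_count_rec:
  assumes T: "tournament V A" and "S \<subseteq> V" and v: "v \<in> S"
  shows "arc_free_count A S = arc_free_count A (S - {v}) +
    2 * (\<Sum>c | c \<in> partial_arrangements (S - {v}) \<and> c \<noteq> [] \<and> even (length c) \<and> arc_walk A (v # c @ [v]).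
           arc_free_count A (S - {v} - set c))"
proof -
  have fin: "finite S"
    using assms finite_subset by (auto simp: tournament_def digraph_def)
  define C where "C = partial_arrangements (S - {v}) - {[]}"
  define h where "h = (\<lambda>c :: 'a list. arc_free_count A (S - {v} - set c))"
  have C: "finite C" "partial_arrangements (S - {v}) = insert [] C" "[] \<notin> C"
    using fin by (auto simp: C_def partial_arrangements_def
        finite_partial_arrangements[unfolded partial_arrangements_def])
  \<comment> \<open>The empty \<open>c\<close> is kept apart: its closed word \<open>[v, v]\<close>
    has equal neighbours, so reversal does not apply. Without a loop at \<open>v\<close> its weight
    is 1.\<close>
  have loop: "(v, v) \<notin> A"
    using assms by (auto simp: tournament_def)
  have "(\<Sum>c\<in>C. of_bool (arc_free A (v # c @ [v])) * h c) =
        (\<Sum>c\<in>C. of_bool (arc_walk A (v # rev c @ [v])) * h c)"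
  proof (intro sum.cong refl)
    fix c assume c: "c \<in> C"
    then have "distinct (v # c)" "c \<noteq> []" "set (v # c @ [v]) \<subseteq> V"
      using assms by (auto simp: C_def partial_arrangements_def)
    then have "distinct_adj (v # c @ [v])"
      by (auto simp: distinct_adj_append_iff distinct_adj_Cons distinct_adj_if_distinct)
    then show "of_bool (arc_free A (v # c @ [v])) * h c = of_bool (arc_walk A (v # rev c @ [v])) * h c"
      using arc_free_iff_arc_walk_rev[OF T, of "v # c @ [v]"] \<open>set (v # c @ [v]) \<subseteq> V\<close> by simp
  qed
  \<comment> \<open>Substituting \<open>rev c\<close> for \<open>c\<close> is harmless because
    \<open>h c\<close> depends only on \<open>set c\<close>.\<close>
  also have "\<dots> = (\<Sum>c\<in>C. of_bool (arc_walk A (v # c @ [v])) * h c)"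
    by (rule sum.reindex_bij_witness[of _ rev rev]) (auto simp: C_def partial_arrangements_def h_def)
  finally have rev: "(\<Sum>c\<in>C. of_bool (arc_free A (v # c @ [v])) * h c) =
        (\<Sum>c\<in>C. of_bool (arc_walk A (v # c @ [v])) * h c)" .
  have "arc_free_count A S = h [] + (\<Sum>c\<in>C. (of_bool (arc_free A (v # c @ [v])) +
      (-1) ^ length c * of_bool (arc_walk A (v # c @ [v]))) * h c)"
    using arc_free_count_expansion[OF fin v, of A] C loop by (simp add: h_def)
  also have "\<dots> = h [] + (\<Sum>c\<in>C. (1 + (-1) ^ length c) * of_bool (arc_walk A (v # c @ [v])) * h c)"
    using rev by (simp add: algebra_simps sum.distrib)
  \<comment> \<open>The factor is 2 for even \<open>length c\<close> and 0 otherwise; the cycle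
    \<open>v # c\<close> has one vertex more, hence odd length.\<close>
  also have "(\<Sum>c\<in>C. (1 + (-1) ^ length c) * of_bool (arc_walk A (v # c @ [v])) * h c) =
      (\<Sum>c | c \<in> C \<and> even (length c) \<and> arc_walk A (v # c @ [v]). 2 * h c)"
    using C(1) by (intro sum.mono_neutral_cong_right) (auto simp: minus_one_power_iff split: if_splits)
  finally show ?thesis
    by (simp add: h_def C_def sum_distrib_left conj_assoc)
qed

text \<open>Redei's theorem: modulo 2 the recursion just deletes \<open>v\<close>, down to the empty
  set with count 1.\<close>

lemma odd_tournament_arc_free_count:
  assumes T: "tournament V A" and "S \<subseteq> V"
  shows "odd (arc_free_count A S)"
proof -
  have "finite S"
    using assms finite_subset by (auto simp: tournament_def digraph_def)
  then show ?thesis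
    using assms(2)
  proof (induction S rule: finite_induct)
    case empty
    show ?case by simp
  next
    case (insert v S)
    then show ?case
      using tournament_arc_free_count_rec[OF T, of "insert v S" v] by simp
  qed
qed

section \<open>Rotation classes and cycles through a vertex\<close>

text \<open>Repeating the head turns the closing arc into an ordinary step, which matches the closed
  words \<open>v # c @ [v]\<close> of the recursion.\<close>

lemma cyclic_tuple_iff_arc_walk: "cyclic_tuple V A xs \<longleftrightarrow>
    xs \<noteq> [] \<and> distinct xs \<and> set xs \<subseteq> V \<and> arc_walk A (xs @ [hd xs])"
  using successively_conv_nth[of "\<lambda>x y. (x, y) \<in> A" xs]
  by (auto simp: cyclic_tuple_def successively_append_iff)

lemma cyclic_tuple_rotate:
  assumes "cyclic_tuple V A xs"
  shows "cyclic_tuple V A (rotate n xs)"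
proof (induction n)
  case (Suc n)
  then obtain x ys where "rotate n xs = x # ys"
    by (cases "rotate n xs") (auto simp: cyclic_tuple_def)
  \<comment> \<open>Rotating once replaces the closed word \<open>x # ys @ [x]\<close> by
    \<open>ys @ [x, hd ys]\<close>: the first arc moves to the end. If \<open>ys\<close> is empty,
    nothing changes.\<close>
  with Suc show ?case
    using successively_append_iff[of "\<lambda>x y. (x, y) \<in> A" "ys @ [x]" "[hd ys]"]
    by (cases ys) (auto simp: cyclic_tuple_iff_arc_walk)
qed (use assms in simp)

text \<open>This replaces the definite description in \<open>cycle_length\<close> by the length of a
  representative.\<close>

lemma mem_nontrivial_odd_dcycles_iff:
  "\<gamma> \<in> nontrivial_odd_dcycles S A \<longleftrightarrow>
    (\<exists>xs. cyclic_tuple S A xs \<and> odd (length xs) \<and> length xs > 1 \<and> \<gamma> = rot_equiv `` {xs})"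
proof -
  have "xs \<noteq> []" if "cyclic_tuple S A xs" for xs
    using that by (simp add: cyclic_tuple_def)
  then show ?thesis
    unfolding nontrivial_odd_dcycles_def dcycles_def quotient_def
    by (auto simp: cycle_length_class)
qed

lemma rot_class_eq_iff:
  assumes "xs \<noteq> []"
  shows "rot_equiv `` {xs} = rot_equiv `` {ys} \<longleftrightarrow> (\<exists>n. ys = rotate n xs)"
proof
  assume "rot_equiv `` {xs} = rot_equiv `` {ys}"
  moreover have "xs \<in> rot_equiv `` {xs}"
    using assms by (auto simp: rot_equiv_def intro: exI[of _ 0])
  ultimately have "(ys, xs) \<in> rot_equiv"
    by blast
  then have "(xs, ys) \<in> rot_equiv"
    using equiv_rot_equiv by (meson equivE symD)
  then show "\<exists>n. ys = rotate n xs"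
    by (auto simp: rot_equiv_def)
next
  assume "\<exists>n. ys = rotate n xs"
  then have "(xs, ys) \<in> rot_equiv"
    using assms by (auto simp: rot_equiv_def)
  then show "rot_equiv `` {xs} = rot_equiv `` {ys}"
    using equiv_rot_equiv by (rule equiv_class_eq[rotated])
qed

text \<open>In a distinct list the head of a rotation determines the offset modulo the length. Hence
  a cycle through \<open>v\<close> has only one representative starting at \<open>v\<close>.\<close>

lemma rotate_same_hd:
  assumes "distinct xs" "xs \<noteq> []" "hd (rotate n xs) = hd xs"
  shows "rotate n xs = xs"
proof -
  have "xs ! (n mod length xs) = xs ! 0"
    using assms by (metis hd_rotate_conv_nth hd_conv_nth)
  then have "n mod length xs = 0"
    using assms by (simp add: nth_eq_iff_index_eq)
  then show ?thesis
    by (metis rotate_conv_mod rotate0 id_apply)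
qed

lemma ex_rotate_hd:
  assumes "v \<in> set xs"
  shows "\<exists>n ys. rotate n xs = v # ys"
proof -
  obtain p q where "xs = p @ v # q"
    using assms split_list by metis
  then have "rotate (length p) xs = v # q @ p"
    by (simp add: rotate_append)
  then show ?thesis
    by blast
qed

lemma finite_nontrivial_odd_dcycles:
  assumes "finite S"
  shows "finite (nontrivial_odd_dcycles S A)"
proof (rule finite_subset)
  show "nontrivial_odd_dcycles S A \<subseteq> (\<lambda>xs. rot_equiv `` {xs}) ` partial_arrangements S"
    by (auto simp: mem_nontrivial_odd_dcycles_iff partial_arrangements_def cyclic_tuple_def)
qed (simp add: finite_partial_arrangements assms)

text \<open>Cycles are sorted by whether they pass through \<open>v\<close>, which is well defined
  since rotation keeps the set of entries. Those that do correspond to the tails \<open>c\<close> of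
  their representatives \<open>v # c\<close>, which exist by \<open>ex_rotate_hd\<close> and are
  unique by \<open>rotate_same_hd\<close>.\<close>

lemma card_nontrivial_odd_dcycles_rec:
  assumes fin: "finite S" and v: "v \<in> S"
  shows "card (nontrivial_odd_dcycles S A) = card (nontrivial_odd_dcycles (S - {v}) A) +
    card {c \<in> partial_arrangements (S - {v}). c \<noteq> [] \<and> even (length c) \<and> arc_walk A (v # c @ [v])}"
proof -
  let ?C = "{c \<in> partial_arrangements (S - {v}). c \<noteq> [] \<and> even (length c) \<and> arc_walk A (v # c @ [v])}"
  let ?f = "\<lambda>c. rot_equiv `` {v # c}"
  have C: "c \<in> ?C \<longleftrightarrow> cyclic_tuple S A (v # c) \<and> odd (length (v # c)) \<and> length (v # c) > 1" for c
    using v by (auto simp: cyclic_tuple_iff_arc_walk partial_arrangements_def)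
  have "nontrivial_odd_dcycles S A = nontrivial_odd_dcycles (S - {v}) A \<union> ?f ` ?C"
  proof (intro set_eqI iffI)
    fix \<gamma> assume "\<gamma> \<in> nontrivial_odd_dcycles S A"
    then obtain xs where xs: "cyclic_tuple S A xs" "odd (length xs)" "length xs > 1" "\<gamma> = rot_equiv `` {xs}"
      by (auto simp: mem_nontrivial_odd_dcycles_iff)
    show "\<gamma> \<in> nontrivial_odd_dcycles (S - {v}) A \<union> ?f ` ?C"
    proof (cases "v \<in> set xs")
      case False
      with xs show ?thesis
        by (auto simp: mem_nontrivial_odd_dcycles_iff cyclic_tuple_def)
    next
      case True
      then obtain n c where n: "rotate n xs = v # c"
        using ex_rotate_hd by metis
      then have "length xs = length (v # c)"
        by (metis length_rotate)
      with xs cyclic_tuple_rotate[OF xs(1), of n] n have "c \<in> ?C"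
        unfolding C by simp
      moreover have "\<gamma> = ?f c"
        using rot_class_eq_iff[of xs "v # c"] xs n by (metis cyclic_tuple_def)
      ultimately show ?thesis
        by blast
    qed
  next
    fix \<gamma> assume "\<gamma> \<in> nontrivial_odd_dcycles (S - {v}) A \<union> ?f ` ?C"
    then show "\<gamma> \<in> nontrivial_odd_dcycles S A"
    proof
      assume "\<gamma> \<in> nontrivial_odd_dcycles (S - {v}) A"
      then show ?thesis
        by (auto simp: mem_nontrivial_odd_dcycles_iff cyclic_tuple_def)
    next
      assume "\<gamma> \<in> ?f ` ?C"
      then obtain c where "c \<in> ?C" "\<gamma> = ?f c"
        by blast
      then show ?thesis
        unfolding C mem_nontrivial_odd_dcycles_iff by blast
    qed
  qed
  moreover have "nontrivial_odd_dcycles (S - {v}) A \<inter> ?f ` ?C = {}"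
  proof -
    have False if xs: "cyclic_tuple (S - {v}) A xs" "rot_equiv `` {xs} = ?f c" for xs c
    proof -
      obtain n where "v # c = rotate n xs"
        using xs rot_class_eq_iff[of xs "v # c"] by (metis cyclic_tuple_def)
      then have "v \<in> set xs"
        by (metis list.set_intros(1) set_rotate)
      with xs show False
        by (auto simp: cyclic_tuple_def)
    qed
    then show ?thesis
      by (fastforce simp: mem_nontrivial_odd_dcycles_iff)
  qed
  moreover have "inj_on ?f ?C"
  proof (rule inj_onI)
    fix c d assume "c \<in> ?C" "?f c = ?f d"
    then obtain n where "v # d = rotate n (v # c)" "distinct (v # c)"
      using rot_class_eq_iff[of "v # c" "v # d"] by (auto simp: partial_arrangements_def)
    then show "c = d"
      using rotate_same_hd[of "v # c" n] by (metis list.inject list.sel(1) list.distinct(1))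
  qed
  moreover have "finite ?C"
    using fin by (simp add: finite_partial_arrangements)
  ultimately show ?thesis
    using fin by (simp add: card_Un_disjoint finite_nontrivial_odd_dcycles card_image)
qed

section \<open>The congruence modulo 4\<close>

lemma tournament_arc_free_count_cong:
  assumes T: "tournament V A" and "S \<subseteq> V"
  shows "[arc_free_count A S = 1 + 2 * int (card (nontrivial_odd_dcycles S A))] (mod 4)"
proof -
  have "finite S"
    using assms finite_subset by (auto simp: tournament_def digraph_def)
  then show ?thesis
    using assms(2)
  proof (induction S rule: finite_induct)
    case empty
    have "nontrivial_odd_dcycles {} A = {}"
      by (auto simp: mem_nontrivial_odd_dcycles_iff cyclic_tuple_def)
    then show ?case by simp
  next
    case (insert v S)
    define C where "C = {c \<in> partial_arrangements S. c \<noteq> [] \<and> even (length c) \<and> arc_walk A (v # c @ [v])}"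
    have "[(\<Sum>c\<in>C. arc_free_count A (S - set c)) = (\<Sum>c\<in>C. 1)] (mod 2)"
    proof (rule cong_sum)
      fix c
      have "odd (arc_free_count A (S - set c))"
        using insert.prems by (intro odd_tournament_arc_free_count[OF T]) auto
      then show "[arc_free_count A (S - set c) = 1] (mod 2)"
        by (simp add: cong_def odd_iff_mod_2_eq_one)
    qed
    \<comment> \<open>Doubling lifts a congruence modulo 2 to one modulo 4, so the parity of the
      remaining counts suffices.\<close>
    then have "[2 * (\<Sum>c\<in>C. arc_free_count A (S - set c)) = 2 * int (card C)] (mod 4)"
      using cong_cmult_leftI[of _ _ 2 2] by fastforce
    moreover have "[arc_free_count A S = 1 + 2 * int (card (nontrivial_odd_dcycles S A))] (mod 4)"
      using insert by simp
    ultimately have "[arc_free_count A S + 2 * (\<Sum>c\<in>C. arc_free_count A (S - set c)) =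
        1 + 2 * int (card (nontrivial_odd_dcycles S A)) + 2 * int (card C)] (mod 4)"
      by (intro cong_add)
    moreover have "arc_free_count A (insert v S) =
        arc_free_count A S + 2 * (\<Sum>c\<in>C. arc_free_count A (S - set c))"
      using tournament_arc_free_count_rec[OF T insert.prems, of v] insert.hyps by (simp add: C_def)
    moreover have "card (nontrivial_odd_dcycles (insert v S) A) =
        card (nontrivial_odd_dcycles S A) + card C"
      using card_nontrivial_odd_dcycles_rec[of "insert v S" v A] insert.hyps by (simp add: C_def)
    ultimately show ?case
      by (simp add: algebra_simps)
  qed
qed

theorem theorem7p1:
  fixes V :: "'a set" and A :: "('a \<times> 'a) set"
  assumes "tournament V A"
  shows "[card {xs. hamp V A xs} = 1 + 2 * card (nontrivial_odd_dcycles V A)] (mod 4)"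
proof -
  have "[int (card {xs. hamp V A xs}) = int (1 + 2 * card (nontrivial_odd_dcycles V A))] (mod int 4)"
    using tournament_arc_free_count_cong[OF assms order_refl] tournament_arc_free_count[OF assms order_refl]
    by simp
  then show ?thesis
    by (simp only: cong_int_iff)
qed

end
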